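(* Let \((P,\lambda)\) be a marked poset with \(P^*\neq\varnothing\) and \(\lambda(P^* )=\{c_0,c_1,\dots,c_k\}\) with \(c_0<c_1<\cdots<c_k\). Set \(c_{-1}=0\) and for \(i=0,\dots,k\) define markings \(\lambda_i\colon P^*\to\mathbb{R}\) by \(\lambda_i(a)=0\) if \(\lambda(a)<c_i\) and \(\lambda_i(a)=1\) if \(\lambda(a)\ge c_i\). Then \[\mathcal{O}(P,\lambda)=\sum_{i=0}^k (c_i-c_{i-1})\,\mathcal{O}(P,\lambda_i)\] (weighted Minkowski sum).
   Context: A marked poset \((P,\lambda)\) is a finite poset \(P\) with an induced subposet \(P^*\subseteq P\) of marked elements and an order-preserving map \(\lambda\colon P^*\to\mathbb{R}\). The marked order polyhedron \(\mathcal{O}(P,\lambda)\subseteq\mathbb{R}^P\) is the set of all \(x\in\mathbb{R}^P\) with \(x_p\le x_q\) whenever \(p\le q\) in \(P\) and \(x_a=\lambda(a)\) for all \(a\in P^*\).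
   Formalization: For unbounded O(P,λ_0) with recession cone C and c_0 ≤ 0, where the claim with pointwise multiples can fail, c_0·O(P,λ_0) is taken as the set of y with y+|c_0|·O(P,λ_0) ⊆ C (so 0·O(P,λ_0)=C); all other multiples are pointwise. *)

theory Defs
  imports "HOL-Analysis.Analysis"
begin

text \<open>
  A finite poset is a type of class \<open>{finite, order}\<close>. A marking is a function on the whole
  type, of which only the values on the set \<open>M\<close> of marked elements matter.
\<close>

definition marked_poset :: "'p::{finite,order} set \<Rightarrow> ('p \<Rightarrow> real) \<Rightarrow> bool" where
  "marked_poset M lam \<longleftrightarrow> mono_on M lam"

definition marked_order_polyhedron ::
    "'p::{finite,order} set \<Rightarrow> ('p \<Rightarrow> real) \<Rightarrow> (real ^ 'p::{finite,order}) set" where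
  "marked_order_polyhedron M lam =
     {x. (\<forall>p q. p \<le> q \<longrightarrow> x $ p \<le> x $ q) \<and> (\<forall>a\<in>M. x $ a = lam a)}"

definition threshold_marking :: "('p \<Rightarrow> real) \<Rightarrow> real \<Rightarrow> 'p \<Rightarrow> real" where
  "threshold_marking lam t a = (if lam a < t then 0 else 1)"

definition recession_cone :: "'v::real_vector set \<Rightarrow> 'v set" where
  "recession_cone Q = {r. \<forall>x\<in>Q. \<forall>t\<ge>0. x + t *\<^sub>R r \<in> Q}"

text \<open>
  The summand \<open>w Q\<close> of a weighted Minkowski sum of polyhedra. For \<open>w > 0\<close>, and for
  every real \<open>w\<close> if \<open>Q\<close> is a polytope, it is the set of all \<open>w x\<close> with
  \<open>x\<close> in \<open>Q\<close>.

  For an unbounded \<open>Q\<close> and \<open>w \<le> 0\<close> the set of all \<open>w x\<close> has the wrong recession cone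
  (the zero cone for \<open>w = 0\<close>, the reflected cone for \<open>w < 0\<close>). There the usual conventions
  for polyhedra with a fixed recession cone \<open>C\<close> apply: \<open>0 Q = C\<close>, the neutral
  element for Minkowski addition of such polyhedra, and for \<open>w < 0\<close> the summand \<open>w Q\<close> is
  the Minkowski difference of \<open>C\<close> and \<open>\<bar>w\<bar> Q\<close>, i.e. the set of all \<open>y\<close> with
  \<open>y + \<bar>w\<bar> Q \<subseteq> C\<close>. For instance \<open>w (v + C) = w v + C\<close> for a convex cone \<open>C\<close>.

  The lemma \<open>pointwise_scaling_fails\<close> below shows that the decomposition of a marked order
  polyhedron can fail for pointwise multiples when the least marking value is negative.
\<close>

definition weighted :: "real \<Rightarrow> 'v::real_normed_vector set \<Rightarrow> 'v set" where
  "weighted w Q =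
     (if w > 0 \<or> bounded Q then (\<lambda>x. w *\<^sub>R x) ` Q
      else {y. \<forall>x\<in>Q. y + \<bar>w\<bar> *\<^sub>R x \<in> recession_cone Q})"

lemma weighted_pos: "w > 0 \<Longrightarrow> weighted w Q = (\<lambda>x. w *\<^sub>R x) ` Q"
  by (simp add: weighted_def)

lemma weighted_bounded: "bounded Q \<Longrightarrow> weighted w Q = (\<lambda>x. w *\<^sub>R x) ` Q"
  by (simp add: weighted_def)

lemma weighted_zero_unbounded: "\<not> bounded Q \<Longrightarrow> weighted 0 Q = recession_cone Q"
  by (auto simp: weighted_def)

lemma weighted_nonpos_translated_cone:
  assumes "convex_cone C" "\<not> bounded C" "w \<le> 0"
  shows "weighted w ((\<lambda>r. v + r) ` C) = (\<lambda>r. w *\<^sub>R v + r) ` C"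
proof -
  have C0: "0 \<in> C" and Cadd: "\<And>r s. r \<in> C \<Longrightarrow> s \<in> C \<Longrightarrow> r + s \<in> C"
    and Cscale: "\<And>r t. r \<in> C \<Longrightarrow> t \<ge> 0 \<Longrightarrow> t *\<^sub>R r \<in> C"
    using assms(1) convex_cone_contains_0 convex_cone_add convex_cone_scaleR by blast+
  have rec: "recession_cone ((\<lambda>r. v + r) ` C) = C"
  proof (intro set_eqI iffI)
    fix r assume "r \<in> recession_cone ((\<lambda>r. v + r) ` C)"
    then have "(v + 0) + 1 *\<^sub>R r \<in> (\<lambda>r. v + r) ` C"
      unfolding recession_cone_def using C0 by (smt (verit) image_eqI mem_Collect_eq)
    then show "r \<in> C" by auto
  next
    fix r assume "r \<in> C"
    then show "r \<in> recession_cone ((\<lambda>r. v + r) ` C)"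
      using Cadd Cscale by (auto simp: recession_cone_def add.assoc)
  qed
  have "(\<lambda>x. - v + x) ` (\<lambda>r. v + r) ` C = C" by (simp add: image_image)
  then have "\<not> bounded ((\<lambda>r. v + r) ` C)"
    using assms(2) bounded_translation[of "(\<lambda>r. v + r) ` C" "- v"] by metis
  then have "weighted w ((\<lambda>r. v + r) ` C) = {y. \<forall>r\<in>C. y - w *\<^sub>R (v + r) \<in> C}"
    using assms(3) by (simp add: weighted_def rec)
  also have "\<dots> = (\<lambda>r. w *\<^sub>R v + r) ` C"
  proof (intro set_eqI iffI)
    fix y assume "y \<in> {y. \<forall>r\<in>C. y - w *\<^sub>R (v + r) \<in> C}"
    then have "y - w *\<^sub>R v \<in> C" using C0 by force
    then show "y \<in> (\<lambda>r. w *\<^sub>R v + r) ` C" by (rule image_eqI[rotated]) simp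
  next
    fix y assume "y \<in> (\<lambda>r. w *\<^sub>R v + r) ` C"
    then obtain s where s: "s \<in> C" "y = w *\<^sub>R v + s" by blast
    have "y - w *\<^sub>R (v + r) = s + (- w) *\<^sub>R r" for r by (simp add: s(2) algebra_simps)
    moreover have "s + (- w) *\<^sub>R r \<in> C" if "r \<in> C" for r
      using Cadd[OF s(1) Cscale[OF that, of "- w"]] assms(3) by simp
    ultimately show "y \<in> {y. \<forall>r\<in>C. y - w *\<^sub>R (v + r) \<in> C}" by simp
  qed
  finally show ?thesis .
qed

lemma pointwise_scaling_fails:
  defines "lam \<equiv> (\<lambda>_::bool. - 1)"
  shows "marked_order_polyhedron {False} lam \<noteq>
    (\<lambda>x. (- 1) *\<^sub>R x) ` marked_order_polyhedron {False} (threshold_marking lam (- 1))"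
proof -
  define x :: "real ^ bool" where "x = (\<chi> p. if p then 0 else - 1)"
  have "x \<in> marked_order_polyhedron {False} lam"
    by (auto simp: x_def marked_order_polyhedron_def lam_def)
  moreover have "x \<notin> (\<lambda>x. (- 1) *\<^sub>R x) ` marked_order_polyhedron {False} (threshold_marking lam (- 1))"
  proof
    assume "x \<in> (\<lambda>x. (- 1) *\<^sub>R x) ` marked_order_polyhedron {False} (threshold_marking lam (- 1))"
    then obtain z where z: "x = - z"
      "z \<in> marked_order_polyhedron {False} (threshold_marking lam (- 1))" by auto
    from z(2) have "\<forall>p q. p \<le> q \<longrightarrow> z $ p \<le> z $ q" "z $ False = 1"
      by (simp_all add: marked_order_polyhedron_def threshold_marking_def lam_def)
    then have "z $ False \<le> z $ True" "z $ False = 1"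
      using le_boolI by blast+
    moreover have "z $ True = 0"
      using z(1) by (metis (full_types) x_def vec_lambda_beta neg_equal_0_iff_equal vector_uminus_component)
    ultimately show False by simp
  qed
  ultimately show ?thesis by metis
qed

end

theory Submission
  imports Defs
begin

text \<open>
  Clamping a point \<open>x\<close> of the polyhedron coordinatewise to \<open>[c (i - 1), c i]\<close> and rescaling
  this interval to \<open>[0, 1]\<close> gives a point of the \<open>i\<close>-th summand for \<open>i \<ge> 1\<close>. What remains
  is the constant vector \<open>c 0\<close> plus the overshoot of \<open>x\<close> below \<open>c 0\<close> and above
  \<open>c k\<close>. The overshoot is order-preserving and vanishes on the marked elements, so it lies in the
  common recession cone. The summand for \<open>i = 0\<close> is a translate of this cone,
  whatever the sign of \<open>c 0\<close>.
\<close>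

text \<open>Indices are integers since \<open>c\<close> is also evaluated at -1. This evaluates the
  sum of the clamps.\<close>

lemma sum_telescope_int:
  fixes f :: "int \<Rightarrow> 'a::ab_group_add"
  assumes "0 \<le> k"
  shows "(\<Sum>i\<in>{1..k}. f i - f (i - 1)) = f k - f 0"
  using assms
proof (induction k rule: int_ge_induct)
  case (step k)
  have "{1..k + 1} = insert (k + 1) {1..k}" using step.hyps by auto
  then show ?case using step.IH by simp
qed simp

text \<open>A nonzero element could be rescaled to norm \<open>B + 1\<close>, beyond any bound
  \<open>B\<close>.\<close>

lemma bounded_convex_cone_eq_0:
  fixes C :: "'a::real_normed_vector set"
  assumes "convex_cone C" "bounded C"
  shows "C = {0}"
proof -
  obtain B where B: "\<And>x. x \<in> C \<Longrightarrow> norm x \<le> B"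
    using assms(2) bounded_iff by blast
  have "r = 0" if r: "r \<in> C" for r
  proof (rule ccontr)
    assume "r \<noteq> 0"
    have "B \<ge> 0" using B[OF r] norm_ge_zero order_trans by blast
    then have "((B + 1) / norm r) *\<^sub>R r \<in> C"
      by (intro convex_cone_scaleR assms(1) r) simp
    from B[OF this] show False using \<open>r \<noteq> 0\<close> \<open>B \<ge> 0\<close> by simp
  qed
  then show ?thesis using convex_cone_contains_0[OF assms(1)] by blast
qed

text \<open>All cases of \<open>weighted\<close> agree on translated cones: a bounded cone is zero,
  and a positive factor maps a cone onto itself. This handles the weight \<open>c 0\<close> of
  unknown sign.\<close>

lemma weighted_translated_cone:
  assumes "convex_cone C"
  shows "weighted w ((\<lambda>r. v + r) ` C) = (\<lambda>r. w *\<^sub>R v + r) ` C"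
proof (cases "bounded C")
  case True
  then have "C = {0}" by (rule bounded_convex_cone_eq_0[OF assms])
  then show ?thesis by (simp add: weighted_bounded)
next
  case False
  show ?thesis
  proof (cases "w > 0")
    case True
    have "(\<lambda>r. w *\<^sub>R r) ` C = C"
    proof (intro set_eqI iffI)
      fix r assume "r \<in> C"
      then have "(1 / w) *\<^sub>R r \<in> C" using True by (intro convex_cone_scaleR assms) auto
      then show "r \<in> (\<lambda>r. w *\<^sub>R r) ` C" using True by (rule_tac image_eqI) auto
    qed (use True assms convex_cone_scaleR in force)
    then have "(\<lambda>r. w *\<^sub>R v + r) ` C = (\<lambda>r. w *\<^sub>R v + r) ` (\<lambda>r. w *\<^sub>R r) ` C" by simp
    then show ?thesis
      using True by (simp add: weighted_pos image_image scaleR_right_distrib)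
  next
    case False
    then show ?thesis
      using \<open>\<not> bounded C\<close> by (intro weighted_nonpos_translated_cone assms) auto
  qed
qed

lemma marked_order_polyhedron_cong:
  assumes "\<And>a. a \<in> M \<Longrightarrow> lam a = mu a"
  shows "marked_order_polyhedron M lam = marked_order_polyhedron M mu"
  using assms by (auto simp: marked_order_polyhedron_def)

lemma convex_cone_marked_order_polyhedron_0:
  "convex_cone (marked_order_polyhedron M (\<lambda>_. 0))"
  by (simp add: convex_cone_iff marked_order_polyhedron_def add_mono mult_left_mono)

lemma marked_order_polyhedron_const:
  "marked_order_polyhedron M (\<lambda>_. t) = (\<lambda>r. vec t + r) ` marked_order_polyhedron M (\<lambda>_. 0)"
proof (intro set_eqI iffI)
  fix x assume "x \<in> marked_order_polyhedron M (\<lambda>_. t)"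
  then have "x - vec t \<in> marked_order_polyhedron M (\<lambda>_. 0)"
    by (simp add: marked_order_polyhedron_def)
  then show "x \<in> (\<lambda>r. vec t + r) ` marked_order_polyhedron M (\<lambda>_. 0)"
    by (rule image_eqI[rotated]) simp
qed (auto simp: marked_order_polyhedron_def)

lemma weighted_marked_order_polyhedron_1:
  fixes M :: "'p::{finite,order} set"
  shows "weighted w (marked_order_polyhedron M (\<lambda>_. 1)) = marked_order_polyhedron M (\<lambda>_. w)"
proof -
  have "w *\<^sub>R vec 1 = (vec w :: real ^ 'p::{finite,order})" by (simp add: vec_eq_iff)
  then show ?thesis
    using weighted_translated_cone[OF convex_cone_marked_order_polyhedron_0[of M], of w "vec 1"]
    unfolding marked_order_polyhedron_const[of M 1] marked_order_polyhedron_const[of M w] by simp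
qed

text \<open>The order inequalities are homogeneous, so scaling by \<open>w\<close> and by
  \<open>1 / w\<close> preserves them.\<close>

lemma weighted_pos_marked_order_polyhedron:
  assumes "w > 0"
  shows "weighted w (marked_order_polyhedron M lam) = marked_order_polyhedron M (\<lambda>a. w * lam a)"
proof (intro set_eqI iffI)
  fix x assume "x \<in> marked_order_polyhedron M (\<lambda>a. w * lam a)"
  then have "(1 / w) *\<^sub>R x \<in> marked_order_polyhedron M lam"
    using assms by (simp add: marked_order_polyhedron_def divide_right_mono)
  then show "x \<in> weighted w (marked_order_polyhedron M lam)"
    unfolding weighted_pos[OF assms] by (rule image_eqI[rotated]) (use assms in simp)
qed (use assms in \<open>auto simp: marked_order_polyhedron_def weighted_pos\<close>)

text \<open>Equality fails in general: let an unmarked \<open>p\<close> lie above two incomparable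
  marked elements, with values 0, 1 in one marking and 1, 0 in the other. The sum forces at least 2
  at \<open>p\<close>, the summed marking only 1.\<close>

lemma sum_marked_order_polyhedron_subset:
  assumes "finite I"
  shows "(\<Sum>i\<in>I. marked_order_polyhedron M (mu i)) \<subseteq>
    marked_order_polyhedron M (\<lambda>a. \<Sum>i\<in>I. mu i a)"
proof
  fix x assume "x \<in> (\<Sum>i\<in>I. marked_order_polyhedron M (mu i))"
  then obtain s where "x = sum s I" "\<forall>i\<in>I. s i \<in> marked_order_polyhedron M (mu i)"
    using assms by (auto simp: set_sum_alt)
  then show "x \<in> marked_order_polyhedron M (\<lambda>a. \<Sum>i\<in>I. mu i a)"
    by (simp add: marked_order_polyhedron_def sum_mono)
qed

theorem theorem4p5:
  fixes M :: "'p::{finite,order} set"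
    and lam :: "'p \<Rightarrow> real"
    and c :: "int \<Rightarrow> real"
    and k :: int
  assumes "marked_poset M lam"
    and "M \<noteq> {}"
    and "lam ` M = c ` {0..k}"
    and "strict_mono_on {0..k} c"
    and "c (- 1) = 0"
  shows "marked_order_polyhedron M lam =
    (\<Sum>i\<in>{0..k}. weighted (c i - c (i - 1))
       (marked_order_polyhedron M (threshold_marking lam (c i))))"
proof -
  have k: "0 \<le> k" using assms(2,3) by fastforce
  have less: "c i < c j" if "0 \<le> i" "i < j" "j \<le> k" for i j
    using that assms(4) by (auto intro: strict_mono_onD)
  have le: "c i \<le> c j" if "0 \<le> i" "i \<le> j" "j \<le> k" for i j
    using less[of i j] that by (cases "i = j") auto
  have split: "{0..k} = insert 0 {1..k}" using k by auto
  \<comment> \<open>For \<open>c (i - 1) \<le> c i\<close> this is the length of the part of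
    \<open>[c (i - 1), c i]\<close> below \<open>t\<close>. It is used for \<open>i \<ge> 1\<close>
    only, since \<open>c (- 1) = 0\<close> may exceed \<open>c 0\<close>.\<close>
  define clamp where "clamp i t = min t (c i) - min t (c (i - 1))" for i t
  \<comment> \<open>The marking of summand \<open>i\<close> once its weight is absorbed.\<close>
  define mu where "mu i = (if i = 0 then (\<lambda>_. c 0) else (\<lambda>a. clamp i (lam a)))" for i
  have clamp_sum: "(\<Sum>i\<in>{1..k}. clamp i t) = min t (c k) - min t (c 0)" for t
    unfolding clamp_def using sum_telescope_int[OF k, of "\<lambda>i. min t (c i)"] by simp
  have lam_value: "\<exists>j\<in>{0..k}. lam a = c j" if "a \<in> M" for a
    using imageI[OF that, of lam] unfolding assms(3) by auto
  have lam_bounds: "c 0 \<le> lam a \<and> lam a \<le> c k" if "a \<in> M" for a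
  proof -
    obtain j where "j \<in> {0..k}" "lam a = c j" using lam_value \<open>a \<in> M\<close> by blast
    then show ?thesis using le[of 0 j] le[of j k] by auto
  qed
  have summand: "weighted (c i - c (i - 1))
      (marked_order_polyhedron M (threshold_marking lam (c i))) =
      marked_order_polyhedron M (mu i)" if i: "i \<in> {0..k}" for i
  proof (cases "i = 0")
    case True
    \<comment> \<open>Every marked value reaches the least threshold \<open>c 0\<close>.\<close>
    have "marked_order_polyhedron M (threshold_marking lam (c 0)) =
        marked_order_polyhedron M (\<lambda>_. 1)"
      by (rule marked_order_polyhedron_cong)
        (use lam_bounds in \<open>force simp: threshold_marking_def\<close>)
    then show ?thesis
      using True assms(5) by (simp add: mu_def weighted_marked_order_polyhedron_1)
  next
    case False
    then have w: "c i - c (i - 1) > 0" using i less[of "i - 1" i] by simp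
    have "(c i - c (i - 1)) * threshold_marking lam (c i) a = mu i a" if a: "a \<in> M" for a
    proof -
      \<comment> \<open>No marked value lies strictly between \<open>c (i - 1)\<close> and
        \<open>c i\<close>, so the clamp is either 0 or the full weight.\<close>
      obtain j where j: "j \<in> {0..k}" "lam a = c j" using lam_value a by blast
      show ?thesis
      proof (cases "j < i")
        case True
        then have "c j < c i" "c j \<le> c (i - 1)" using less[of j i] le[of j "i - 1"] i j by auto
        then show ?thesis using False j by (simp add: mu_def clamp_def threshold_marking_def)
      next
        case ge: False
        then have "c i \<le> c j" using le[of i j] i j by auto
        then show ?thesis using False j w by (simp add: mu_def clamp_def threshold_marking_def)
      qed
    qed
    then show ?thesis
      unfolding weighted_pos_marked_order_polyhedron[OF w] by (rule marked_order_polyhedron_cong)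
  qed
  have "marked_order_polyhedron M lam = (\<Sum>i\<in>{0..k}. marked_order_polyhedron M (mu i))"
  proof
    have "(\<Sum>i\<in>{0..k}. mu i a) = lam a" if "a \<in> M" for a
    proof -
      \<comment> \<open>As \<open>lam a\<close> lies in \<open>[c 0, c k]\<close>, the clamps add up
        to \<open>lam a - c 0\<close>, and index 0 contributes the missing
        \<open>c 0\<close>.\<close>
      have "(\<Sum>i\<in>{1..k}. mu i a) = (\<Sum>i\<in>{1..k}. clamp i (lam a))"
        by (rule sum.cong) (auto simp: mu_def)
      then show ?thesis
        using lam_bounds[OF that] by (simp add: split clamp_sum) (simp add: mu_def)
    qed
    then have "marked_order_polyhedron M (\<lambda>a. \<Sum>i\<in>{0..k}. mu i a) = marked_order_polyhedron M lam"
      by (rule marked_order_polyhedron_cong)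
    then show "(\<Sum>i\<in>{0..k}. marked_order_polyhedron M (mu i)) \<subseteq> marked_order_polyhedron M lam"
      using sum_marked_order_polyhedron_subset[of "{0..k}" M mu] by simp
  next
    show "marked_order_polyhedron M lam \<subseteq> (\<Sum>i\<in>{0..k}. marked_order_polyhedron M (mu i))"
    proof
      fix x assume "x \<in> marked_order_polyhedron M lam"
      then have x: "\<And>p q. p \<le> q \<Longrightarrow> x $ p \<le> x $ q" "\<And>a. a \<in> M \<Longrightarrow> x $ a = lam a"
        by (auto simp: marked_order_polyhedron_def)
      \<comment> \<open>The entry at index 0 is what the telescoped clamps leave of
        \<open>x $ p\<close>.\<close>
      define s where "s i = (\<chi> p. if i = 0 then x $ p - min (x $ p) (c k) + min (x $ p) (c 0)
        else clamp i (x $ p))" for i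
      have "s i \<in> marked_order_polyhedron M (mu i)" if i: "i \<in> {0..k}" for i
      proof (cases "i = 0")
        case True
        \<comment> \<open>As a function of \<open>x $ p\<close>, the entry has slope 1 below
          \<open>c 0\<close>, 0 up to \<open>c k\<close> and 1 above, hence is monotone.\<close>
        have "s 0 $ p \<le> s 0 $ q" if "p \<le> q" for p q
          using x(1)[OF that] le[of 0 k] k by (simp add: s_def min_def)
        moreover have "s 0 $ a = c 0" if "a \<in> M" for a
          using x(2)[OF that] lam_bounds[OF that] by (simp add: s_def)
        ultimately show ?thesis
          using True by (simp add: marked_order_polyhedron_def mu_def)
      next
        case False
        then have "c (i - 1) < c i" using i less[of "i - 1" i] by simp
        then have "s i $ p \<le> s i $ q" if "p \<le> q" for p q
          using x(1)[OF that] False by (simp add: s_def clamp_def min_def)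
        then show ?thesis
          using False x(2) by (simp add: marked_order_polyhedron_def mu_def s_def)
      qed
      moreover have "x = (\<Sum>i\<in>{0..k}. s i)"
      proof -
        have "(\<Sum>i\<in>{1..k}. s i $ p) = (\<Sum>i\<in>{1..k}. clamp i (x $ p))" for p
          by (rule sum.cong) (auto simp: s_def)
        then show ?thesis
          by (simp add: vec_eq_iff split clamp_sum) (simp add: s_def)
      qed
      ultimately show "x \<in> (\<Sum>i\<in>{0..k}. marked_order_polyhedron M (mu i))"
        by (auto simp: set_sum_alt)
    qed
  qed
  then show ?thesis using summand by simp
qed

end
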